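(* Let $m$ be an odd and $n$ an even nonnegative integer, let $0\le k\le\min(m,n)$, and let $m'=m+n-2k$. Let $X=c_{m,n,k}\left(\frac{m+1}{2},\frac n2\right)$ be the lower-right entry of the central $2\times2$ square of $M(m,n,k)$, so that $$X=(-1)^{\frac k2}\,\frac{m-k+1}{m+1}\,\frac{\left(\frac{m+n-k+1}{2}\right)!}{\left(\frac{m-k+1}{2}\right)!\left(\frac{n-k}{2}\right)!\left(\frac k2\right)!}\ \text{ if } k \text{ is even},\qquad X=(-1)^{\frac{k+1}2}\,\frac{k+1}{m+1}\,\frac{\left(\frac{m+n-k}{2}\right)!}{\left(\frac{m-k}{2}\right)!\left(\frac{n-k-1}{2}\right)!\left(\frac{k+1}{2}\right)!}\ \text{ if } k\text{ is odd}.$$ For $0\le s\le\frac{m-1}{2}$, let $B_sX$ be the entry of $M(m,n,k)$ lying $s$ rows below $X$ in the same column (that is, $c_{m,n,k}(\frac{m+1}2+s,\frac n2-s)$), and let $A_sX$ be the entry immediately to the left of it (that is, $c_{m,n,k}(\frac{m+1}{2}+s,\frac n2-s-1)$). Then, with $\lambda_s=s(s+2)$, $$A_0=\frac{m'-m}{m'+1}\ \text{ if }k\text{ is even},\qquad A_0=\frac{m'+m+2}{m'+1}\ \text{ if }k\text{ is odd},\qquad B_0=1,$$ and, for $0\le s<\frac{m-1}{2}$, $$A_{s+1}=\frac{(\lambda_{m'}-\lambda_m+\lambda_{2s+1}+1)A_s+(\lambda_{2s}-\lambda_n)B_s}{\lambda_m-\lambda_{2s+1}},\qquad B_{s+1}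=\frac{(\lambda_{m'}+1)A_s+(\lambda_{2s}-\lambda_n)B_s}{\lambda_m-\lambda_{2s+1}}.$$
   Context: For integers $m,n,k,i,j$ with $0\le k\le\min(m,n)$, $0\le i\le m$, $0\le j\le n$, $0\le i+j-k\le m+n-2k$, define $$c_{m,n,k}(i,j)=\sum_{l=0}^{k}(-1)^l\binom{i+j-k}{i-l}\binom{m-l}{k-l}\binom{n-k+l}{l},$$ where $\binom{a}{b}=0$ if $b<0$ or $b>a$. The matrix $M(m,n,k)$ has $m+1$ rows and $m+n-2k+1$ columns; its entry in row $i+1$ and column $i+j-k+1$ is $c_{m,n,k}(i,j)$ when $0\le j\le n$, and $0$ when $j<0$ or $j>n$ (so $c_{m,n,k}(i,j)$ is extended by zero to all entries of $M(m,n,k)$). *)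

theory Defs
  imports Complex_Main "Jordan_Normal_Form.Matrix"
begin

definition binom :: "int \<Rightarrow> int \<Rightarrow> int" where
  "binom a b = (if b < 0 \<or> b > a then 0 else int (nat a choose nat b))"

(* The indices i, j are integers because j becomes negative at the zero entries of the matrix below;
   the value is 0 whenever (i, j) is not an admissible pair. *)
definition cg :: "nat \<Rightarrow> nat \<Rightarrow> nat \<Rightarrow> int \<Rightarrow> int \<Rightarrow> int" where
  "cg m n k i j =
     (if 0 \<le> i \<and> i \<le> int m \<and> 0 \<le> j \<and> j \<le> int n \<and>
         0 \<le> i + j - int k \<and> i + j - int k \<le> int m + int n - 2 * int k
      then (\<Sum>l = 0..k. (- 1) ^ l * binom (i + j - int k) (i - int l)
              * binom (int m - int l) (int k - int l) * binom (int n - int k + int l) (int l))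
      else 0)"

(* Rows and columns are counted from 0: row i and column i + j - k hold the value at (i, j),
   so the entry in row r and column q has i = r and j = q - r + k. *)
definition cg_mat :: "nat \<Rightarrow> nat \<Rightarrow> nat \<Rightarrow> int mat" where
  "cg_mat m n k = mat (m + 1) (m + n - 2 * k + 1)
     (\<lambda>(r, q). cg m n k (int r) (int q - int r + int k))"

definition lam :: "nat \<Rightarrow> rat" where
  "lam s = of_nat s * (of_nat s + 2)"

end

theory Submission
  imports Defs
begin

text \<open>
  For fixed \<open>N = i + j - k\<close> the coefficient satisfies Pascal's rule
  \<open>c(i,j) = c(i-1,j) + c(i,j-1)\<close>. The transvectant sums
  \<open>E(i,j) = \<Sum>l. (-1)^l (i)_l (n-j)_l / l! \<sqdot> (m-i)_(k-l) (j)_(k-l) / (k-l)!\<close> (falling factorials) satisfy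
  \<open>N E(i,j) = i E(i-1,j) + j E(i,j-1)\<close>, and comparison at \<open>N = 0\<close> gives
  \<open>i! j! c(i,j) = N! E(i,j)\<close>. Since \<open>E\<close> is symmetric up to the sign \<open>(-1)^k\<close> under
  \<open>(i,j) \<leftrightarrow> (m-i,n-j)\<close>, Pascal's rule reflects to
  \<open>(i+1)(m-i) c(i+1,j-1) + j(n+1-j) c(i,j) = N(m'+1-N) c(i,j-1)\<close>;
  at \<open>N = (m'+1)/2\<close> this is the recurrence for \<open>B\<close>, and Pascal's rule turns it into the one for \<open>A\<close>.
  The same symmetry relates the diagonal entries of the central square, which gives \<open>A 0\<close>.
  The central value \<open>X\<close> reduces to the well-poised sums \<open>S k = \<Sum>l. (-1)^l h l h(k-l)\<close>
  and \<open>R k = \<Sum>l. (-1)^l (l-(k-l)) h l h(k-l)\<close>, with \<open>h l = (a)_l (b)_l / l!\<close>.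
  One of them vanishes according to the parity of \<open>k\<close>, and each of them determines the other
  one at \<open>k + 1\<close>.
\<close>

section \<open>Paired falling factorials and their contiguity relations\<close>

definition ffact_pair :: "'a::field_char_0 \<Rightarrow> 'a \<Rightarrow> nat \<Rightarrow> 'a" where
  "ffact_pair a b l = fact l * (a gchoose l) * (b gchoose l)"

lemma ffact_pair_0 [simp]: "ffact_pair a b 0 = 1"
  by (simp add: ffact_pair_def)

lemma ffact_pair_commute: "ffact_pair a b l = ffact_pair b a l"
  by (simp add: ffact_pair_def)

lemma gbinomial_Suc_mult: "of_nat (Suc l) * (a gchoose Suc l) = (a - of_nat l) * (a gchoose l)"
  for a :: "'a::field_char_0"
  by (simp only: gbinomial_absorption gbinomial_absorb_comp)

text \<open>The single factorial against two binomials leaves one denominator \<open>l!\<close>, so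
  raising \<open>l\<close> costs one division but gains a factor from each argument.\<close>

lemma ffact_pair_Suc:
  "of_nat (Suc l) * ffact_pair a b (Suc l) = (a - of_nat l) * (b - of_nat l) * ffact_pair a b l"
proof -
  have "of_nat (Suc l) * ffact_pair a b (Suc l)
      = fact l * (of_nat (Suc l) * (a gchoose Suc l)) * (of_nat (Suc l) * (b gchoose Suc l))"
    by (simp only: ffact_pair_def fact_Suc mult_ac of_nat_mult)
  then show ?thesis unfolding gbinomial_Suc_mult by (simp add: ffact_pair_def mult_ac)
qed

text \<open>Pascal's rule splits the binomial of \<open>a + 1\<close>; in the extra term the surplus
  factor \<open>Suc l\<close> is absorbed by the binomial of \<open>b\<close>.\<close>

lemma ffact_pair_plus1:
  "ffact_pair (a + 1) b (Suc l) = ffact_pair a b (Suc l) + (b - of_nat l) * ffact_pair a b l"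
proof -
  have "ffact_pair (a + 1) b (Suc l)
      = ffact_pair a b (Suc l) + fact l * (a gchoose l) * (of_nat (Suc l) * (b gchoose Suc l))"
    unfolding ffact_pair_def gbinomial_Suc_Suc fact_Suc by (simp add: algebra_simps)
  then show ?thesis unfolding gbinomial_Suc_mult by (simp add: ffact_pair_def mult_ac)
qed

lemma ffact_pair_absorb: "a * ffact_pair (a - 1) b l = (a - of_nat l) * ffact_pair a b l"
  using gbinomial_absorb_comp[of a l] by (simp add: ffact_pair_def mult_ac)

section \<open>Transvectant sums: symmetry and the two Pascal rules\<close>

definition transv :: "'a::field_char_0 \<Rightarrow> 'a \<Rightarrow> 'a \<Rightarrow> 'a \<Rightarrow> nat \<Rightarrow> 'a" where
  "transv a b u v k = (\<Sum>l\<le>k. (- 1) ^ l * ffact_pair a v l * ffact_pair u b (k - l))"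

lemma alternating_sum_reverse:
  fixes f :: "nat \<Rightarrow> nat \<Rightarrow> 'a::comm_ring_1"
  shows "(\<Sum>l\<le>k. (- 1) ^ l * f l (k - l)) = (- 1) ^ k * (\<Sum>l\<le>k. (- 1) ^ l * f (k - l) l)"
proof -
  have "(\<Sum>l\<le>k. (- 1) ^ l * f l (k - l)) = (\<Sum>l\<le>k. (- 1) ^ (k - l) * f (k - l) l)"
    by (rule sum.reindex_bij_witness[of _ "\<lambda>l. k - l" "\<lambda>l. k - l"]) auto
  also have "\<dots> = (\<Sum>l\<le>k. (- 1) ^ k * ((- 1) ^ l * f (k - l) l))"
    by (rule sum.cong) (auto simp: minus_one_power_iff)
  finally show ?thesis by (simp add: sum_distrib_left)
qed

text \<open>Reversing the summation exchanges the two factors of each term. With \<open>a\<close>,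
  \<open>b\<close>, \<open>u\<close>, \<open>v\<close> standing for i, j, m - i, n - j this is the
  point reflection of the coefficient array; keeping four independent arguments makes it a mere
  exchange of variables.\<close>

lemma transv_swap: "transv u v a b k = (- 1) ^ k * transv a b u v k"
  unfolding transv_def mult.assoc
  by (subst alternating_sum_reverse[where f = "\<lambda>l j. ffact_pair u b l * ffact_pair a v j"])
     (simp add: mult_ac)

text \<open>Absorption turns the prefactors \<open>a\<close> and \<open>b\<close> into a - l and b -
  (k - l), whose sum is a + b - k. The raised arguments \<open>u + 1\<close> and
  \<open>v + 1\<close> each produce a correction sum, and the two corrections cancel.\<close>

lemma transv_pascal:
  "(a + b - of_nat k) * transv a b u v k
    = a * transv (a - 1) b (u + 1) v k + b * transv a (b - 1) u (v + 1) k"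
proof (cases k)
  case 0
  then show ?thesis by (simp add: transv_def)
next
  case (Suc q)
  \<comment> \<open>The common correction term: it arises from \<open>u + 1\<close> with index
    \<open>l\<close>, and from \<open>v + 1\<close> with index \<open>Suc l\<close>, hence with the
    opposite sign.\<close>
  let ?c = "\<lambda>l. (- 1) ^ l * (a - of_nat l) * ffact_pair a v l * (b - of_nat (q - l)) * ffact_pair u b (q - l)"
  have "a * transv (a - 1) b (u + 1) v k
      = (\<Sum>l\<le>k. (- 1) ^ l * (a * ffact_pair (a - 1) v l) * ffact_pair (u + 1) b (k - l))"
    by (simp add: transv_def sum_distrib_left mult_ac)
  also have "\<dots> = (\<Sum>l\<le>q. (- 1) ^ l * (a - of_nat l) * ffact_pair a v l * ffact_pair u b (k - l) + ?c l)
      + (- 1) ^ k * (a - of_nat k) * ffact_pair a v k"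
  proof -
    have e: "ffact_pair (u + 1) b (k - l) = ffact_pair u b (k - l) + (b - of_nat (q - l)) * ffact_pair u b (q - l)"
      if "l \<le> q" for l
      using that unfolding Suc by (simp only: Suc_diff_le ffact_pair_plus1)
    have "(\<Sum>l\<le>q. (- 1) ^ l * ((a - of_nat l) * ffact_pair a v l) * ffact_pair (u + 1) b (k - l))
        = (\<Sum>l\<le>q. (- 1) ^ l * (a - of_nat l) * ffact_pair a v l * ffact_pair u b (k - l) + ?c l)"
      by (intro sum.cong refl, simp only: atMost_iff e) (simp add: algebra_simps del: of_nat_diff)
    then show ?thesis
      unfolding ffact_pair_absorb by (simp add: Suc del: of_nat_diff)
  qed
  finally have 1: "a * transv (a - 1) b (u + 1) v k
      = (\<Sum>l\<le>k. (- 1) ^ l * (a - of_nat l) * ffact_pair a v l * ffact_pair u b (k - l)) + (\<Sum>l\<le>q. ?c l)"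
    by (simp add: Suc sum.distrib)
  have "b * transv a (b - 1) u (v + 1) k
      = (\<Sum>l\<le>k. (- 1) ^ l * ffact_pair (v + 1) a l * (b * ffact_pair (b - 1) u (k - l)))"
    by (simp add: transv_def sum_distrib_left mult_ac ffact_pair_commute[of a "v + 1"] ffact_pair_commute[of u "b - 1"])
  also have "\<dots> = (b - of_nat k) * ffact_pair u b k
      + (\<Sum>l\<le>q. (- 1) ^ Suc l * (b - of_nat (q - l)) * ffact_pair a v (Suc l) * ffact_pair u b (q - l) - ?c l)"
  proof -
    have e: "ffact_pair (v + 1) a (Suc l) = ffact_pair a v (Suc l) + (a - of_nat l) * ffact_pair a v l" for l
      by (simp only: ffact_pair_plus1 ffact_pair_commute[of v a])
    have "(\<Sum>l\<le>q. (- 1) ^ Suc l * ffact_pair (v + 1) a (Suc l) * ((b - of_nat (q - l)) * ffact_pair u b (q - l)))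
      = (\<Sum>l\<le>q. (- 1) ^ Suc l * (b - of_nat (q - l)) * ffact_pair a v (Suc l) * ffact_pair u b (q - l) - ?c l)"
      by (intro sum.cong refl, simp only: e) (simp add: algebra_simps del: of_nat_diff)
    then show ?thesis
      unfolding ffact_pair_absorb unfolding Suc sum.atMost_Suc_shift
      by (simp add: ffact_pair_commute[of b u] del: of_nat_diff)
  qed
  finally have 2: "b * transv a (b - 1) u (v + 1) k
      = (\<Sum>l\<le>k. (- 1) ^ l * (b - of_nat (k - l)) * ffact_pair a v l * ffact_pair u b (k - l)) - (\<Sum>l\<le>q. ?c l)"
    unfolding Suc sum.atMost_Suc_shift by (simp add: sum_subtractf)
  have "(a + b - of_nat k) * transv a b u v k
      = (\<Sum>l\<le>k. (- 1) ^ l * (a - of_nat l) * ffact_pair a v l * ffact_pair u b (k - l))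
        + (\<Sum>l\<le>k. (- 1) ^ l * (b - of_nat (k - l)) * ffact_pair a v l * ffact_pair u b (k - l))"
    unfolding transv_def sum_distrib_left sum.distrib[symmetric]
    by (rule sum.cong) (auto simp: of_nat_diff algebra_simps)
  then show ?thesis using 1 2 by simp
qed

lemma transv_pascal_reflected:
  "(u + v - of_nat k) * transv a b u v k
    = u * transv (a + 1) b (u - 1) v k + v * transv a (b + 1) u (v - 1) k"
proof -
  have "(- 1) ^ k * ((u + v - of_nat k) * transv a b u v k)
      = (- 1) ^ k * (u * transv (a + 1) b (u - 1) v k + v * transv a (b + 1) u (v - 1) k)"
    using transv_pascal[of u v k a b]
    by (simp add: transv_swap[of u v] transv_swap[of "u - 1"] transv_swap[of u "v - 1"] algebra_simps)
  then show ?thesis by simp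
qed

section \<open>Well-poised alternating sums\<close>

definition dixon :: "'a::field_char_0 \<Rightarrow> 'a \<Rightarrow> nat \<Rightarrow> 'a" where
  "dixon a b k = (\<Sum>l\<le>k. (- 1) ^ l * (ffact_pair a b l * ffact_pair a b (k - l)))"

definition dixon_diff :: "'a::field_char_0 \<Rightarrow> 'a \<Rightarrow> nat \<Rightarrow> 'a" where
  "dixon_diff a b k = (\<Sum>l\<le>k. (- 1) ^ l * ((of_nat l - of_nat (k - l)) * ffact_pair a b l * ffact_pair a b (k - l)))"

lemma dixon_odd: "odd k \<Longrightarrow> dixon a b k = 0"
  using alternating_sum_reverse[where f = "\<lambda>l j. ffact_pair a b l * ffact_pair a b j" and k = k]
  by (simp add: dixon_def mult_ac)

lemma dixon_diff_even: "even k \<Longrightarrow> dixon_diff a b k = 0"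
proof -
  assume "even k"
  then have "dixon_diff a b k
      = (\<Sum>l\<le>k. (- 1) ^ l * ((of_nat (k - l) - of_nat l) * ffact_pair a b (k - l) * ffact_pair a b l))"
    unfolding dixon_diff_def
    by (subst alternating_sum_reverse[where f = "\<lambda>l j. (of_nat l - of_nat j) * ffact_pair a b l * ffact_pair a b j"])
       simp
  also have "\<dots> = - dixon_diff a b k"
    unfolding dixon_diff_def sum_negf[symmetric] by (rule sum.cong) (auto simp: algebra_simps)
  finally show ?thesis by simp
qed

text \<open>Absorption replaces \<open>a - 1\<close> by \<open>a\<close> at the cost of the weight a
  - (k - l). Twice this weight is the constant 2a - k plus l - (k - l), the part that is
  antisymmetric under reversal.\<close>

lemma transv_eq_dixon:
  "2 * a * transv a b (a - 1) b k = (2 * a - of_nat k) * dixon a b k + dixon_diff a b k"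
proof -
  have "2 * a * transv a b (a - 1) b k
      = (\<Sum>l\<le>k. (- 1) ^ l * ffact_pair a b l * (2 * (a * ffact_pair (a - 1) b (k - l))))"
    by (simp add: transv_def sum_distrib_left mult_ac)
  also have "\<dots> = (\<Sum>l\<le>k. (2 * a - of_nat k) * ((- 1) ^ l * (ffact_pair a b l * ffact_pair a b (k - l)))
      + (- 1) ^ l * ((of_nat l - of_nat (k - l)) * ffact_pair a b l * ffact_pair a b (k - l)))"
    unfolding ffact_pair_absorb by (rule sum.cong) (auto simp: of_nat_diff algebra_simps)
  finally show ?thesis
    by (simp add: dixon_def dixon_diff_def sum.distrib sum_distrib_left)
qed

text \<open>A weight l removes the denominator, the term l = 0 drops out, and shifting the index
  shortens the convolution by one. The sign changes here, but not in the mirror version, where the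
  weight sits on the other factor.\<close>

lemma ffact_pair_sum_shift_left:
  "(\<Sum>l\<le>Suc k. (- 1) ^ l * (of_nat l * ffact_pair a b l * g (Suc k - l)))
    = - (\<Sum>l\<le>k. (- 1) ^ l * ((a - of_nat l) * (b - of_nat l) * ffact_pair a b l * g (k - l)))"
  unfolding sum.atMost_Suc_shift
  by (simp add: sum_negf ffact_pair_Suc del: of_nat_Suc of_nat_add)

lemma ffact_pair_sum_shift_right:
  "(\<Sum>l\<le>Suc k. (- 1) ^ l * (g l * (of_nat (Suc k - l) * ffact_pair a b (Suc k - l))))
    = (\<Sum>l\<le>k. (- 1) ^ l * (g l * ((a - of_nat (k - l)) * (b - of_nat (k - l)) * ffact_pair a b (k - l))))"
proof -
  have "(- 1) ^ l * (g l * (of_nat (Suc k - l) * ffact_pair a b (Suc k - l)))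
    = (- 1) ^ l * (g l * ((a - of_nat (k - l)) * (b - of_nat (k - l)) * ffact_pair a b (k - l)))"
    if "l \<le> k" for l
    using that by (simp only: Suc_diff_le ffact_pair_Suc)
  then have "(\<Sum>l\<le>k. (- 1) ^ l * (g l * (of_nat (Suc k - l) * ffact_pair a b (Suc k - l))))
    = (\<Sum>l\<le>k. (- 1) ^ l * (g l * ((a - of_nat (k - l)) * (b - of_nat (k - l)) * ffact_pair a b (k - l))))"
    by (intro sum.cong) simp_all
  then show ?thesis by (simp del: of_nat_diff)
qed

text \<open>Split the factor k + 1 as l + (k + 1 - l) and shorten both parts. With j = k - l, the
  weight (a - j)(b - j) - (a - l)(b - l) factors as (l - j)(a + b - k).\<close>

lemma dixon_Suc: "of_nat (Suc k) * dixon a b (Suc k) = (a + b - of_nat k) * dixon_diff a b k"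
proof -
  let ?h = "ffact_pair a b"
  have "of_nat (Suc k) * dixon a b (Suc k)
     = (\<Sum>l\<le>Suc k. (- 1) ^ l * (of_nat l * ?h l * ?h (Suc k - l)))
       + (\<Sum>l\<le>Suc k. (- 1) ^ l * (?h l * (of_nat (Suc k - l) * ?h (Suc k - l))))"
    unfolding dixon_def sum_distrib_left sum.distrib[symmetric]
    by (rule sum.cong) (auto simp: of_nat_diff algebra_simps)
  also have "\<dots> = (a + b - of_nat k) * dixon_diff a b k"
    unfolding ffact_pair_sum_shift_left ffact_pair_sum_shift_right dixon_diff_def sum_distrib_left sum_negf[symmetric]
      sum.distrib[symmetric]
    by (rule sum.cong) (auto simp: of_nat_diff algebra_simps)
  finally show ?thesis .
qed

text \<open>Here the two shortened parts add up, with weight -(a - l)(b - l) - (a - j)(b - j) where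
  j = k - l. Since l^2 + j^2 = k^2 - 2lj, everything except the product lj is constant in l. The sum
  \<open>Q\<close> over that product is then eliminated by a second linear relation.\<close>

lemma dixon_diff_Suc:
  "(2 * (a + b) - of_nat k) * dixon_diff a b (Suc k)
    = - (a + b - of_nat k) * (2 * a - of_nat k) * (2 * b - of_nat k) * dixon a b k"
proof -
  let ?h = "ffact_pair a b"
  define Q where "Q = (\<Sum>l\<le>k. (- 1) ^ l * (of_nat l * of_nat (k - l) * ?h l * ?h (k - l)))"
  have 1: "dixon_diff a b (Suc k) = (2 * Q) - (2 * a * b - (a + b) * of_nat k + of_nat k ^ 2) * dixon a b k"
  proof -
    have "dixon_diff a b (Suc k)
     = (\<Sum>l\<le>Suc k. (- 1) ^ l * (of_nat l * ?h l * ?h (Suc k - l)))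
       - (\<Sum>l\<le>Suc k. (- 1) ^ l * (?h l * (of_nat (Suc k - l) * ?h (Suc k - l))))"
      unfolding dixon_diff_def sum_subtractf[symmetric]
      by (rule sum.cong) (auto simp: algebra_simps)
    also have "\<dots> = (2 * Q) - (2 * a * b - (a + b) * of_nat k + of_nat k ^ 2) * dixon a b k"
      unfolding ffact_pair_sum_shift_left ffact_pair_sum_shift_right dixon_def Q_def sum_distrib_left sum_negf[symmetric]
        sum_subtractf[symmetric]
      by (rule sum.cong) (auto simp: of_nat_diff algebra_simps power2_eq_square)
    finally show ?thesis .
  qed
  \<comment> \<open>the summand \<open>(-1)^l h l h(k-l) (l (a-(k-l)) (b-(k-l)) + (k-l) (a-l) (b-l))\<close> telescopes\<close>
  have 2: "(2 * (a + b) - of_nat k) * Q = of_nat k * a * b * dixon a b k"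
  proof (cases k)
    case 0
    then show ?thesis by (simp add: Q_def)
  next
    case (Suc q)
    have "(\<Sum>l\<le>k. (- 1) ^ l * (of_nat l * ?h l
             * ((a - of_nat (k - l)) * (b - of_nat (k - l)) * ?h (k - l))))
        = - (\<Sum>l\<le>k. (- 1) ^ l * (((a - of_nat l) * (b - of_nat l) * ?h l)
             * (of_nat (k - l) * ?h (k - l))))"
      unfolding Suc
      by (subst ffact_pair_sum_shift_left[where g = "\<lambda>j. (a - of_nat j) * (b - of_nat j) * ?h j"],
          subst ffact_pair_sum_shift_right[where g = "\<lambda>j. (a - of_nat j) * (b - of_nat j) * ?h j"])
         (rule refl)
    then have "(\<Sum>l\<le>k. (- 1) ^ l * (of_nat l * ?h l
             * ((a - of_nat (k - l)) * (b - of_nat (k - l)) * ?h (k - l))))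
        + (\<Sum>l\<le>k. (- 1) ^ l * (((a - of_nat l) * (b - of_nat l) * ?h l)
             * (of_nat (k - l) * ?h (k - l)))) = 0" by simp
    also have "(\<Sum>l\<le>k. (- 1) ^ l * (of_nat l * ?h l
             * ((a - of_nat (k - l)) * (b - of_nat (k - l)) * ?h (k - l))))
        + (\<Sum>l\<le>k. (- 1) ^ l * (((a - of_nat l) * (b - of_nat l) * ?h l)
             * (of_nat (k - l) * ?h (k - l))))
      = of_nat k * a * b * dixon a b k - (2 * (a + b) - of_nat k) * Q"
      unfolding dixon_def Q_def sum_distrib_left sum_subtractf[symmetric] sum.distrib[symmetric]
      by (rule sum.cong) (auto simp: of_nat_diff algebra_simps)
    finally show ?thesis by simp
  qed
  have "(2 * (a + b) - of_nat k) * dixon_diff a b (Suc k) = 2 * ((2 * (a + b) - of_nat k) * Q)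
     - (2 * (a + b) - of_nat k) * (2 * a * b - (a + b) * of_nat k + of_nat k ^ 2) * dixon a b k"
    unfolding 1 by (simp add: algebra_simps)
  then show ?thesis unfolding 2 by (simp add: algebra_simps power2_eq_square)
qed


text \<open>A terminating case of Dixon's theorem on the well-poised 3F2 at 1, obtained by two steps
  of the mutual recursion, from 2h through \<open>dixon_diff\<close> at 2h + 1 to 2h + 2. The
  factorials are multiplied out to avoid quotients.\<close>

lemma dixon_double:
  assumes "h \<le> a" "h \<le> b"
  shows "dixon (of_nat a) (of_nat b) (2 * h) * (fact (a + b - 2 * h) * fact (a - h) * fact (b - h) * fact h)
    = (- 1) ^ h * fact a * fact b * (fact (a + b - h) :: 'a::field_char_0)"
  using assms
proof (induction h)
  case 0
  then show ?case by (simp add: dixon_def)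
next
  case (Suc h)
  then obtain x y where xy: "a = Suc (h + x)" "b = Suc (h + y)"
    by (metis Suc_le_eq less_iff_Suc_add)
  let ?a = "of_nat a :: 'a" and ?b = "of_nat b :: 'a"
  define D0 D1 R where "D0 = dixon ?a ?b (2 * h)" and "D1 = dixon ?a ?b (2 * Suc h)"
    and "R = dixon_diff ?a ?b (Suc (2 * h))"
  define H Z Y where "H = (of_nat h :: 'a)" and "Z = (of_nat x :: 'a)" and "Y = (of_nat y :: 'a)"
  \<comment> \<open>Half of the coefficient 2(a + b) - 2h in \<open>dixon_diff_Suc\<close>, which
    has to be cancelled.\<close>
  have nz: "H + Z + Y + 2 \<noteq> 0"
  proof -
    have "H + Z + Y + 2 = of_nat (h + x + y + 2)" by (simp add: H_def Z_def Y_def)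
    then show ?thesis by (metis of_nat_eq_0_iff add_is_0 zero_neq_numeral)
  qed
  have "2 * ((H + Z + Y + 2) * R) = 2 * (- (Z + Y + 2) * 2 * (Z + 1) * (Y + 1) * D0)"
    using dixon_diff_Suc[of ?a ?b "2 * h"]
    by (simp add: D0_def R_def xy H_def Z_def Y_def algebra_simps)
  then have 1: "(H + Z + Y + 2) * R = - (Z + Y + 2) * 2 * (Z + 1) * (Y + 1) * D0"
    by simp
  have 2: "2 * (H + 1) * D1 = (Z + Y + 1) * R"
    using dixon_Suc[of "Suc (2 * h)" ?a ?b]
    by (simp add: D1_def R_def xy H_def Z_def Y_def algebra_simps)
  have "2 * ((H + Z + Y + 2) * (H + 1) * D1) = (H + Z + Y + 2) * (2 * (H + 1) * D1)"
    by (simp only: mult_ac)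
  also have "\<dots> = (Z + Y + 1) * ((H + Z + Y + 2) * R)"
    unfolding 2 by (simp only: mult_ac)
  also have "\<dots> = 2 * (- ((Z + Y + 1) * (Z + Y + 2) * (Z + 1) * (Y + 1)) * D0)"
    unfolding 1 by (simp add: algebra_simps)
  finally have 3: "(H + Z + Y + 2) * (H + 1) * D1
      = - ((Z + Y + 1) * (Z + Y + 2) * (Z + 1) * (Y + 1)) * D0"
    by (rule mult_left_cancel[THEN iffD1, rotated]) simp
  have f: "fact (Suc (Suc (x + y))) = (Z + Y + 2) * (Z + Y + 1) * fact (x + y)"
    "fact (Suc x) = (Z + 1) * fact x" "fact (Suc y) = (Y + 1) * fact y"
    "fact (Suc h) = (H + 1) * fact h"
    "fact (Suc (Suc (h + x + y))) = (H + Z + Y + 2) * fact (Suc (h + x + y))"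
    by (simp_all add: H_def Z_def Y_def algebra_simps)
  have IH: "D0 * (fact (Suc (Suc (x + y))) * fact (Suc x) * fact (Suc y) * fact h)
      = (- 1) ^ h * fact a * fact b * fact (Suc (Suc (h + x + y)))"
  proof -
    have "a + b - 2 * h = Suc (Suc (x + y))" "a - h = Suc x" "b - h = Suc y"
      "a + b - h = Suc (Suc (h + x + y))"
      by (auto simp: xy)
    then show ?thesis using Suc by (simp add: D0_def)
  qed
  have "(H + Z + Y + 2) * (D1 * (fact (x + y) * fact x * fact y * fact (Suc h)))
      = (H + Z + Y + 2) * (H + 1) * D1 * (fact (x + y) * fact x * fact y * fact h)"
    unfolding f by (simp only: mult_ac)
  also have "\<dots> = - (D0 * (fact (Suc (Suc (x + y))) * fact (Suc x) * fact (Suc y) * fact h))"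
    unfolding 3 f by (simp only: mult_ac mult_minus_left mult_minus_right)
  also have "\<dots> = (H + Z + Y + 2) * ((- 1) ^ Suc h * fact a * fact b * fact (Suc (h + x + y)))"
    unfolding IH unfolding f by (simp add: mult_ac)
  finally have "D1 * (fact (x + y) * fact x * fact y * fact (Suc h))
      = (- 1) ^ Suc h * fact a * fact b * fact (Suc (h + x + y))"
    using nz by (simp only: mult_cancel_left simp_thms)
  moreover have "a + b - 2 * Suc h = x + y" "a - Suc h = x" "b - Suc h = y"
    "a + b - Suc h = Suc (h + x + y)"
    by (auto simp: xy)
  ultimately show ?case by (simp only: D1_def)
qed

text \<open>One application of \<open>dixon_diff_Suc\<close> to the value in
  \<open>dixon_double\<close>.\<close>

lemma dixon_diff_double:
  assumes "h < a" "h < b"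
  shows "dixon_diff (of_nat a) (of_nat b) (Suc (2 * h))
      * (fact (a + b - Suc (2 * h)) * fact (a - Suc h) * fact (b - Suc h) * fact h)
    = - (2 * ((- 1) ^ h * fact a * fact b * (fact (a + b - Suc h) :: 'a::field_char_0)))"
proof -
  obtain x y where xy: "a = Suc (h + x)" "b = Suc (h + y)"
    using assms by (metis less_iff_Suc_add)
  let ?a = "of_nat a :: 'a" and ?b = "of_nat b :: 'a"
  define D R where "D = dixon ?a ?b (2 * h)" and "R = dixon_diff ?a ?b (Suc (2 * h))"
  define H Z Y where "H = (of_nat h :: 'a)" and "Z = (of_nat x :: 'a)" and "Y = (of_nat y :: 'a)"
  have nz: "H + Z + Y + 2 \<noteq> 0"
  proof -
    have "H + Z + Y + 2 = of_nat (h + x + y + 2)" by (simp add: H_def Z_def Y_def)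
    then show ?thesis by (metis of_nat_eq_0_iff add_is_0 zero_neq_numeral)
  qed
  have "2 * ((H + Z + Y + 2) * R) = 2 * (- (Z + Y + 2) * 2 * (Z + 1) * (Y + 1) * D)"
    using dixon_diff_Suc[of ?a ?b "2 * h"]
    by (simp add: D_def R_def xy H_def Z_def Y_def algebra_simps)
  then have 1: "(H + Z + Y + 2) * R = - (Z + Y + 2) * 2 * (Z + 1) * (Y + 1) * D"
    by simp
  have f: "fact (Suc (Suc (x + y))) = (Z + Y + 2) * fact (Suc (x + y))"
    "fact (Suc x) = (Z + 1) * fact x" "fact (Suc y) = (Y + 1) * fact y"
    "fact (Suc (Suc (h + x + y))) = (H + Z + Y + 2) * fact (Suc (h + x + y))"
    by (simp_all add: H_def Z_def Y_def algebra_simps)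
  have e: "a + b - 2 * h = Suc (Suc (x + y))" "a - h = Suc x" "b - h = Suc y"
    "a + b - h = Suc (Suc (h + x + y))"
    by (auto simp: xy)
  have D: "D * (fact (Suc (Suc (x + y))) * fact (Suc x) * fact (Suc y) * fact h)
      = (- 1) ^ h * fact a * fact b * fact (Suc (Suc (h + x + y)))"
    using dixon_double[of h a b, where 'a = 'a] assms unfolding e D_def by simp
  have "(H + Z + Y + 2) * (R * (fact (Suc (x + y)) * fact x * fact y * fact h))
      = (H + Z + Y + 2) * R * (fact (Suc (x + y)) * fact x * fact y * fact h)"
    by (simp only: mult_ac)
  also have "\<dots> = - (2 * (D * (fact (Suc (Suc (x + y))) * fact (Suc x) * fact (Suc y) * fact h)))"
    unfolding 1 f by (simp only: mult_ac mult_minus_left mult_minus_right)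
  also have "\<dots> = (H + Z + Y + 2) * (- (2 * ((- 1) ^ h * fact a * fact b * fact (Suc (h + x + y)))))"
    unfolding D unfolding f by (simp only: mult_ac mult_minus_left mult_minus_right)
  finally have "R * (fact (Suc (x + y)) * fact x * fact y * fact h)
      = - (2 * ((- 1) ^ h * fact a * fact b * fact (Suc (h + x + y))))"
    using nz by (simp only: mult_cancel_left simp_thms)
  moreover have "a + b - Suc (2 * h) = Suc (x + y)" "a - Suc h = x" "b - Suc h = y"
    "a + b - Suc h = Suc (h + x + y)"
    by (auto simp: xy)
  ultimately show ?thesis by (simp only: R_def)
qed

section \<open>The coefficients as transvectant sums\<close>

lemma binom_of_nat: "binom (int a) (int b) = int (a choose b)"
  by (simp add: binom_def)

lemma binom_pascal: "binom (int (Suc N)) b = binom (int N) b + binom (int N) (b - 1)"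
proof (cases "b \<le> 0")
  case True
  then show ?thesis by (auto simp: binom_def)
next
  case False
  then obtain c where b: "b = int (Suc c)"
    by (metis not_le pos_int_cases gr0_implies_Suc)
  have "b - 1 = int c" using b by simp
  then show ?thesis unfolding b binom_of_nat by (simp only: binom_of_nat binomial_Suc_Suc of_nat_add add.commute)
qed

text \<open>Parametrised by N = i + j - k and freed from the range conditions of \<open>cg\<close>,
  so that Pascal's rule and induction on \<open>N\<close> need no boundary cases.\<close>

definition cg_sum :: "nat \<Rightarrow> nat \<Rightarrow> nat \<Rightarrow> nat \<Rightarrow> int \<Rightarrow> int" where
  "cg_sum m n k N i = (\<Sum>l = 0..k. (- 1) ^ l * binom (int N) (i - int l)
     * binom (int m - int l) (int k - int l) * binom (int n - int k + int l) (int l))"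

lemma cg_sum_Suc: "cg_sum m n k (Suc N) i = cg_sum m n k N i + cg_sum m n k N (i - 1)"
  unfolding cg_sum_def binom_pascal sum.distrib[symmetric]
  by (rule sum.cong) (auto simp: algebra_simps)

lemma cg_sum_neg: "i < 0 \<Longrightarrow> cg_sum m n k N i = 0"
  unfolding cg_sum_def by (rule sum.neutral) (auto simp: binom_def)

lemma cg_sum_large: "int N + int k < i \<Longrightarrow> cg_sum m n k N i = 0"
  unfolding cg_sum_def by (rule sum.neutral) (auto simp: binom_def)

text \<open>For negative \<open>j\<close> the index \<open>i\<close> exceeds N + k, where the sum
  vanishes by itself; the extension by zero therefore agrees with the unrestricted sum on this
  side.\<close>

lemma cg_eq_cg_sum:
  assumes "0 \<le> i" "i \<le> int m" "j \<le> int n" "i + j - int k = int N"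
    "int N \<le> int m + int n - 2 * int k"
  shows "cg m n k i j = cg_sum m n k N i"
proof (cases "0 \<le> j")
  case True
  then show ?thesis using assms by (simp add: cg_def cg_sum_def)
next
  case False
  then have "cg_sum m n k N i = 0" using assms by (intro cg_sum_large) simp
  then show ?thesis using False by (simp add: cg_def)
qed

text \<open>Induction on \<open>N\<close>: after scaling by the factorials both sides obey the same
  Pascal rule, so agreement at N = 0 is enough.\<close>

lemma cg_sum_eq_transv:
  assumes "k \<le> m" "k \<le> n" "i + j = N + k"
  shows "fact i * fact j * of_int (cg_sum m n k N (int i))
    = (fact N * transv (of_nat i) (of_nat j) (of_nat m - of_nat i) (of_nat n - of_nat j) k :: 'a::field_char_0)"
  using assms(3)
proof (induction N arbitrary: i j)
  case 0
  then have k: "k = i + j" by simp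
  \<comment> \<open>At N = 0 only l = i survives on both sides. In the transvectant sum the falling
    factorials of i and of j = k - i vanish for l > i and l < i respectively.\<close>
  have *: "binom 0 (int i - int l) = (if l = i then 1 else 0)" for l
    by (auto simp: binom_def)
  have "cg_sum m n k 0 (int i) = (\<Sum>l\<in>{0..k}. if l = i then (- 1) ^ i
     * binom (int m - int i) (int k - int i) * binom (int n - int k + int i) (int i) else 0)"
    unfolding cg_sum_def by (rule sum.cong) (auto simp: *)
  also have "\<dots> = (- 1) ^ i * binom (int (m - i)) (int j) * binom (int (n - j)) (int i)"
    using assms k by (simp add: of_nat_diff algebra_simps)
  finally have 1: "cg_sum m n k 0 (int i) = (- 1) ^ i * int (m - i choose j) * int (n - j choose i)"
    by (simp only: binom_of_nat)
  have mi: "of_nat m - of_nat i = (of_nat (m - i) :: 'a)" "of_nat n - of_nat j = (of_nat (n - j) :: 'a)"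
    using assms k by auto
  have "transv (of_nat i) (of_nat j) (of_nat m - of_nat i) (of_nat n - of_nat j) k
     = (\<Sum>l\<le>k. if l = i then (- 1) ^ i * (fact i * of_nat (n - j choose i))
          * (fact j * of_nat (m - i choose j)) else 0 :: 'a)"
    unfolding transv_def mi ffact_pair_def binomial_gbinomial[symmetric]
    by (rule sum.cong) (use k in \<open>auto simp: binomial_eq_0_iff\<close>)
  also have "\<dots> = (- 1) ^ i * (fact i * of_nat (n - j choose i)) * (fact j * of_nat (m - i choose j))"
    using k by simp
  finally show ?case unfolding 1 by simp
next
  case (Suc N)
  let ?u = "of_nat m - of_nat i :: 'a" and ?v = "of_nat n - of_nat j :: 'a"
  have 1: "fact i * fact j * of_int (cg_sum m n k N (int i - 1))
      = fact N * (of_nat i * transv (of_nat i - 1) (of_nat j) (?u + 1) ?v k)"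
  \<comment> \<open>At i = 0 the prefactor kills the transvectant with argument -1, and the
    coefficient is zero as well. The case j = 0 below is analogous.\<close>
  proof (cases i)
    case 0
    then show ?thesis by (simp add: cg_sum_neg)
  next
    case (Suc i')
    with Suc.prems Suc.IH[of i' j] show ?thesis by (simp add: algebra_simps)
  qed
  have 2: "fact i * fact j * of_int (cg_sum m n k N (int i))
      = fact N * (of_nat j * transv (of_nat i) (of_nat j - 1) ?u (?v + 1) k)"
  proof (cases j)
    case 0
    then show ?thesis using Suc.prems by (simp add: cg_sum_large)
  next
    case (Suc j')
    with Suc.prems Suc.IH[of i j'] show ?thesis by (simp add: algebra_simps)
  qed
  have N: "of_nat i + of_nat j - of_nat k = (of_nat (Suc N) :: 'a)"
    using Suc.prems by (metis add_diff_cancel_right' of_nat_add)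
  have "fact i * fact j * of_int (cg_sum m n k (Suc N) (int i))
    = fact N * (of_nat i * transv (of_nat i - 1) (of_nat j) (?u + 1) ?v k)
      + fact N * (of_nat j * transv (of_nat i) (of_nat j - 1) ?u (?v + 1) k)"
    unfolding 1[symmetric] 2[symmetric] by (simp add: cg_sum_Suc algebra_simps)
  also have "\<dots> = fact N * (of_nat (Suc N) * transv (of_nat i) (of_nat j) ?u ?v k)"
    unfolding N[symmetric] transv_pascal by (simp only: distrib_left)
  finally show ?case by (simp add: mult_ac)
qed

text \<open>The reflected Pascal rule carried over to the coefficients. With j = N + k - i, the
  factors in the second term are j + 1 and n - j.\<close>

lemma cg_sum_raise:
  assumes "k \<le> m" "k \<le> n"
  shows "of_nat (Suc i) * (of_nat m - of_nat i) * of_int (cg_sum m n k (Suc N) (int i + 1))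
     + (of_nat (Suc N) + of_nat k - of_nat i) * (of_nat n + of_nat i - of_nat N - of_nat k)
       * of_int (cg_sum m n k (Suc N) (int i))
   = of_nat (Suc N) * (of_nat m + of_nat n - 2 * of_nat k - of_nat N)
       * (of_int (cg_sum m n k N (int i)) :: 'a::field_char_0)"
proof (cases "i \<le> N + k")
  case False
  show ?thesis
  \<comment> \<open>At this border the coefficient in column \<open>Suc N\<close> need not vanish,
    but its prefactor does.\<close>
  proof (cases "i = Suc N + k")
    case True
    then show ?thesis by (simp add: cg_sum_large)
  next
    case neq: False
    with False have "int (Suc N) + int k < int i" by linarith
    then show ?thesis by (simp add: cg_sum_large)
  qed
next
  case True
  then obtain j where j: "i + j = N + k"
    by (metis le_add_diff_inverse)
  then have Nk: "(of_nat N :: 'a) = of_nat i + of_nat j - of_nat k"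
    by (metis add_diff_cancel_right' of_nat_add)
  let ?u = "of_nat m - of_nat i :: 'a" and ?v = "of_nat n - of_nat j :: 'a"
  have 0: "fact i * fact j * of_int (cg_sum m n k N (int i)) = fact N * transv (of_nat i) (of_nat j) ?u ?v k"
    using cg_sum_eq_transv[OF assms j] .
  have 1: "fact i * fact j * (of_nat (Suc i) * of_int (cg_sum m n k (Suc N) (int i + 1)))
      = fact (Suc N) * transv (of_nat i + 1) (of_nat j) (?u - 1) ?v k"
    using cg_sum_eq_transv[OF assms, of "Suc i" j "Suc N", where 'a = 'a] j by (simp add: algebra_simps)
  have 2: "fact i * fact j * (of_nat (Suc j) * of_int (cg_sum m n k (Suc N) (int i)))
      = fact (Suc N) * transv (of_nat i) (of_nat j + 1) ?u (?v - 1) k"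
    using cg_sum_eq_transv[OF assms, of i "Suc j" "Suc N", where 'a = 'a] j by (simp add: algebra_simps)
  have "fact i * fact j * (of_nat (Suc i) * ?u * of_int (cg_sum m n k (Suc N) (int i + 1))
       + of_nat (Suc j) * ?v * of_int (cg_sum m n k (Suc N) (int i)))
     = ?u * (fact i * fact j * (of_nat (Suc i) * of_int (cg_sum m n k (Suc N) (int i + 1))))
       + ?v * (fact i * fact j * (of_nat (Suc j) * of_int (cg_sum m n k (Suc N) (int i))))"
    by (simp only: algebra_simps)
  also have "\<dots> = fact (Suc N) * ((?u + ?v - of_nat k) * transv (of_nat i) (of_nat j) ?u ?v k)"
    unfolding 1 2 transv_pascal_reflected by (simp only: algebra_simps)
  also have "\<dots> = of_nat (Suc N) * (?u + ?v - of_nat k)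
      * (fact N * transv (of_nat i) (of_nat j) ?u ?v k)"
    by (simp add: mult_ac)
  also have "\<dots> = fact i * fact j
      * (of_nat (Suc N) * (?u + ?v - of_nat k) * of_int (cg_sum m n k N (int i)))"
    unfolding 0[symmetric] by (simp only: mult_ac)
  finally have "of_nat (Suc i) * ?u * of_int (cg_sum m n k (Suc N) (int i + 1))
       + of_nat (Suc j) * ?v * of_int (cg_sum m n k (Suc N) (int i))
     = of_nat (Suc N) * (?u + ?v - of_nat k) * of_int (cg_sum m n k N (int i))"
    by (simp only: mult_cancel_left) simp
  then show ?thesis by (simp add: Nk algebra_simps)
qed

section \<open>The central square and the recurrence below it\<close>

theorem theorem6:
  fixes m n k m' row col :: nat and X :: rat and A B :: "nat \<Rightarrow> rat"
  assumes "odd m" and "even n" and "k \<le> min m n"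
    and "m' = m + n - 2 * k"
    and "row = (m + 1) div 2" and "col = (m' + 1) div 2"
    and "X = of_int (cg m n k (int ((m + 1) div 2)) (int (n div 2)))"
    and "\<And>s. s \<le> (m - 1) div 2 \<Longrightarrow> B s * X = of_int (cg_mat m n k $$ (row + s, col))"
    and "\<And>s. s \<le> (m - 1) div 2 \<Longrightarrow> A s * X = of_int (cg_mat m n k $$ (row + s, col - 1))"
  shows
    "of_int (cg_mat m n k $$ (row, col)) = X \<and>
     (\<forall>s \<le> (m - 1) div 2.
        cg_mat m n k $$ (row + s, col)
          = cg m n k (int ((m + 1) div 2) + int s) (int (n div 2) - int s) \<and>
        cg_mat m n k $$ (row + s, col - 1)
          = cg m n k (int ((m + 1) div 2) + int s) (int (n div 2) - int s - 1)) \<and>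
     (even k \<longrightarrow>
        X = (- 1) ^ (k div 2) * ((of_nat m - of_nat k + 1) / (of_nat m + 1))
            * (fact ((m + n - k + 1) div 2)
               / (fact ((m - k + 1) div 2) * fact ((n - k) div 2) * fact (k div 2)))) \<and>
     (odd k \<longrightarrow>
        X = (- 1) ^ ((k + 1) div 2) * ((of_nat k + 1) / (of_nat m + 1))
            * (fact ((m + n - k) div 2)
               / (fact ((m - k) div 2) * fact ((n - k - 1) div 2) * fact ((k + 1) div 2)))) \<and>
     (even k \<longrightarrow> A 0 = (of_nat m' - of_nat m) / (of_nat m' + 1)) \<and>
     (odd k \<longrightarrow> A 0 = (of_nat m' + of_nat m + 2) / (of_nat m' + 1)) \<and>
     B 0 = 1 \<and>
     (\<forall>s < (m - 1) div 2.
        A (s + 1) = ((lam m' - lam m + lam (2 * s + 1) + 1) * A s + (lam (2 * s) - lam n) * B s)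
                    / (lam m - lam (2 * s + 1)) \<and>
        B (s + 1) = ((lam m' + 1) * A s + (lam (2 * s) - lam n) * B s)
                    / (lam m - lam (2 * s + 1)))"
proof -
  obtain p where m: "m = 2 * p + 1" using \<open>odd m\<close> by (auto elim: oddE)
  obtain r where n: "n = 2 * r" using \<open>even n\<close> by (auto elim: evenE)
  have k: "k \<le> m" "k \<le> n" using \<open>k \<le> min m n\<close> by auto
  then have "k \<le> p + r" by (simp add: m n)
  then obtain M where M: "p + r = M + k" by (metis le_add_diff_inverse2)
  \<comment> \<open>Columns correspond to N, so the central columns are \<open>M\<close> and
    \<open>Suc M\<close>, and the central rows are \<open>p\<close> and
    \<open>Suc p\<close>.\<close>
  have m': "m' = 2 * M + 1" using assms(4) M by (simp add: m n)
  have row: "row = Suc p" and col: "col = Suc M" and hm: "(m - 1) div 2 = p"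
    using assms(5,6) by (simp_all add: m m')
  have Mint: "int p + int r = int M + int k" using M by (metis of_nat_add)
  have Mrat: "rat_of_nat p + of_nat r = of_nat M + of_nat k" using M by (metis of_nat_add)
  define C where "C N i = rat_of_int (cg_sum m n k N (int i))" for N i

  have entries: "cg_mat m n k $$ (row + s, col)
          = cg m n k (int ((m + 1) div 2) + int s) (int (n div 2) - int s)"
    "cg_mat m n k $$ (row + s, col - 1)
          = cg m n k (int ((m + 1) div 2) + int s) (int (n div 2) - int s - 1)"
    "of_int (cg_mat m n k $$ (row + s, col)) = C (Suc M) (Suc p + s)"
    "of_int (cg_mat m n k $$ (row + s, col - 1)) = C M (Suc p + s)" if "s \<le> p" for s
  proof -
    have idx: "row + s < m + 1" "col < m + n - 2 * k + 1" "col - 1 < m + n - 2 * k + 1"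
      using that M by (auto simp: row col m n)
    have j: "int col - int (row + s) + int k = int r - int s"
      "int (col - 1) - int (row + s) + int k = int r - int s - 1"
      using Mint by (simp_all add: row col)
    have i: "int (row + s) = int ((m + 1) div 2) + int s" "int (n div 2) = int r"
      by (simp_all add: row m n)
    show 1: "cg_mat m n k $$ (row + s, col)
          = cg m n k (int ((m + 1) div 2) + int s) (int (n div 2) - int s)"
      using idx unfolding cg_mat_def by (simp only: index_mat case_prod_conv j) (simp only: i)
    show 2: "cg_mat m n k $$ (row + s, col - 1)
          = cg m n k (int ((m + 1) div 2) + int s) (int (n div 2) - int s - 1)"
      using idx unfolding cg_mat_def by (simp only: index_mat case_prod_conv j) (simp only: i)
    have ip: "int ((m + 1) div 2) + int s = int (Suc p + s)" by (simp add: m)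
    show "of_int (cg_mat m n k $$ (row + s, col)) = C (Suc M) (Suc p + s)"
      unfolding 1 C_def ip i using that Mint
      by (subst cg_eq_cg_sum[of _ m _ n k "Suc M"]) (auto simp: m n)
    show "of_int (cg_mat m n k $$ (row + s, col - 1)) = C M (Suc p + s)"
      unfolding 2 C_def ip i using that Mint
      by (subst cg_eq_cg_sum[of _ m _ n k M]) (auto simp: m n)
  qed

  have X: "X = C (Suc M) (Suc p)"
    using entries(1,3)[of 0] assms(7) by simp
  have B: "B s * X = C (Suc M) (Suc p + s)" and A: "A s * X = C M (Suc p + s)" if "s \<le> p" for s
    using assms(8,9)[of s, unfolded hm, OF that] entries(3,4)[OF that] by simp_all

  let ?P = "rat_of_nat (Suc p)" and ?r = "rat_of_nat r"
  have mn: "of_nat m - ?P = ?P - 1" "of_nat m - of_nat p = ?P" "of_nat n - ?r = ?r"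
    by (simp_all add: m n)
  have EX: "fact (Suc p) * fact r * X = fact (Suc M) * transv ?P ?r (?P - 1) ?r k"
    using cg_sum_eq_transv[OF k, of "Suc p" r "Suc M", where 'a = rat] M by (simp only: X C_def mn)
  \<comment> \<open>The upper-left entry of the central square is the point reflection of
    \<open>X\<close>, so the same transvectant appears up to sign.\<close>
  have EX': "fact p * fact r * C M p = fact M * ((- 1) ^ k * transv ?P ?r (?P - 1) ?r k)"
    using cg_sum_eq_transv[OF k, of p r M, where 'a = rat] M
    by (simp only: C_def mn transv_swap[symmetric]) simp
  have reflect: "of_nat (Suc M) * C M p = (- 1) ^ k * (?P * X)"
  proof -
    have "fact p * fact r * (of_nat (Suc M) * C M p) = of_nat (Suc M) * (fact p * fact r * C M p)"
      by (simp only: mult_ac)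
    also have "\<dots> = (- 1) ^ k * (fact (Suc M) * transv ?P ?r (?P - 1) ?r k)"
      unfolding EX' by (simp only: fact_Suc mult_ac)
    also have "\<dots> = fact p * fact r * ((- 1) ^ k * (?P * X))"
      unfolding EX[symmetric] by (simp only: fact_Suc mult_ac)
    finally show ?thesis by (simp only: mult_cancel_left) simp
  qed
  have closed: "2 * ?P * fact (Suc p) * fact r * X
      = fact (Suc M) * ((2 * ?P - of_nat k) * dixon ?P ?r k + dixon_diff ?P ?r k)"
  proof -
    have "2 * ?P * fact (Suc p) * fact r * X = 2 * ?P * (fact (Suc p) * fact r * X)"
      by (simp only: mult_ac)
    also have "\<dots> = fact (Suc M) * (2 * ?P * transv ?P ?r (?P - 1) ?r k)"
      unfolding EX by (simp only: mult_ac)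
    finally show ?thesis unfolding transv_eq_dixon .
  qed

  have X_even: "X = (- 1) ^ (k div 2) * ((of_nat m - of_nat k + 1) / (of_nat m + 1))
            * (fact ((m + n - k + 1) div 2)
               / (fact ((m - k + 1) div 2) * fact ((n - k) div 2) * fact (k div 2)))" if par: "even k"
  proof -
    obtain h where h: "k = 2 * h" using par by (auto elim: evenE)
    then have hp: "h \<le> p" "h \<le> r" using k by (auto simp: m n)
    let ?D = "dixon ?P ?r (2 * h)" and ?s = "(- 1) ^ h :: rat"
    have f: "fact (Suc p - h) = rat_of_nat (Suc p - h) * fact (p - h)"
      using hp by (simp add: Suc_diff_le)
    \<comment> \<open>For even \<open>k\<close> only the \<open>dixon\<close> term of
      \<open>closed\<close> survives, with this coefficient.\<close>
    have c: "2 * ?P - of_nat k = 2 * rat_of_nat (Suc p - h)" using hp by (simp add: h of_nat_diff)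
    have M': "Suc p + r - 2 * h = Suc M" using M h by simp
    have D: "?D * (fact (Suc M) * fact (Suc p - h) * fact (r - h) * fact h)
        = ?s * fact (Suc p) * fact r * fact (Suc p + r - h)"
      using dixon_double[of h "Suc p" r, where 'a = rat] hp by (simp only: M')
    have "2 * fact (Suc p) * fact r * (?P * X * (fact (Suc p - h) * fact (r - h) * fact h))
        = (2 * ?P * fact (Suc p) * fact r * X) * (fact (Suc p - h) * fact (r - h) * fact h)"
      by (simp only: mult_ac)
    also have "\<dots> = 2 * rat_of_nat (Suc p - h) * (?D * (fact (Suc M) * fact (Suc p - h) * fact (r - h) * fact h))"
      unfolding closed c dixon_diff_even[OF par] by (simp only: h add_0_right mult_ac)
    also have "\<dots> = 2 * fact (Suc p) * fact r * (?s * rat_of_nat (Suc p - h) * fact (Suc p + r - h))"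
      unfolding D by (simp only: mult_ac)
    finally have "?P * X * (fact (Suc p - h) * fact (r - h) * fact h)
        = ?s * rat_of_nat (Suc p - h) * fact (Suc p + r - h)"
      by (simp only: mult_cancel_left) simp
    then have "X = ?s * (rat_of_nat (Suc p - h) / ?P)
        * (fact (Suc p + r - h) / (fact (Suc p - h) * fact (r - h) * fact h))"
      by (simp add: field_simps del: of_nat_Suc fact_Suc)
    moreover have "rat_of_nat (Suc p - h) / ?P = (of_nat m - of_nat k + 1) / (of_nat m + 1)"
    proof -
      have "of_nat m - of_nat k + 1 = 2 * rat_of_nat (Suc p - h)" "of_nat m + 1 = 2 * ?P"
        using hp by (simp_all add: m h of_nat_diff)
      then show ?thesis by (simp del: of_nat_Suc)
    qed
    moreover have "(m + n - k + 1) div 2 = Suc p + r - h" "(m - k + 1) div 2 = Suc p - h"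
      "(n - k) div 2 = r - h" "k div 2 = h"
      using hp by (auto simp: m n h)
    ultimately show ?thesis by (simp only:)
  qed
  have X_odd: "X = (- 1) ^ ((k + 1) div 2) * ((of_nat k + 1) / (of_nat m + 1))
            * (fact ((m + n - k) div 2)
               / (fact ((m - k) div 2) * fact ((n - k - 1) div 2) * fact ((k + 1) div 2)))" if par: "odd k"
  proof -
    obtain h where h: "k = Suc (2 * h)" using par by (auto elim: oddE)
    then have hp: "h \<le> p" "h < r" using k by (auto simp: m n)
    let ?R = "dixon_diff ?P ?r k" and ?s = "(- 1) ^ h :: rat"
    have M': "Suc p + r - Suc (2 * h) = Suc M" using M h by simp
    have R: "?R * (fact (Suc M) * fact (p - h) * fact (r - Suc h) * fact h)
        = - (2 * (?s * fact (Suc p) * fact r * fact (p + r - h)))"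
      using dixon_diff_double[of h "Suc p" r, where 'a = rat] hp by (simp only: M' h) simp
    have "2 * fact (Suc p) * fact r * (?P * X * (fact (p - h) * fact (r - Suc h) * fact h))
        = (2 * ?P * fact (Suc p) * fact r * X) * (fact (p - h) * fact (r - Suc h) * fact h)"
      by (simp only: mult_ac)
    \<comment> \<open>For odd \<open>k\<close> only the \<open>dixon_diff\<close> term of
      \<open>closed\<close> survives.\<close>
    also have "\<dots> = ?R * (fact (Suc M) * fact (p - h) * fact (r - Suc h) * fact h)"
      unfolding closed dixon_odd[OF par] by (simp only: mult_zero_right mult_zero_left add_0_left mult_ac)
    also have "\<dots> = 2 * fact (Suc p) * fact r * (- ?s * fact (p + r - h))"
      unfolding R by (simp only: mult_ac mult_minus_left mult_minus_right)
    finally have "?P * X * (fact (p - h) * fact (r - Suc h) * fact h) = - ?s * fact (p + r - h)"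
      by (simp only: mult_cancel_left) simp
    \<comment> \<open>The extra factor \<open>Suc h\<close>, which is (k + 1)/2, completes
      \<open>fact h\<close> to the factorial in the stated formula.\<close>
    then have "?P * X * (fact (p - h) * fact (r - Suc h) * fact (Suc h))
        = - ?s * of_nat (Suc h) * fact (p + r - h)"
      unfolding fact_Suc by (metis (no_types, lifting) mult.assoc mult.commute)
    then have "X = - ?s * (of_nat (Suc h) / ?P)
        * (fact (p + r - h) / (fact (p - h) * fact (r - Suc h) * fact (Suc h)))"
      by (simp add: field_simps del: of_nat_Suc fact_Suc)
    moreover have "of_nat (Suc h) / ?P = (of_nat k + 1) / (of_nat m + 1)"
    proof -
      have "of_nat k + 1 = 2 * rat_of_nat (Suc h)" "of_nat m + 1 = 2 * ?P"
        by (simp_all add: m h)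
      then show ?thesis by (simp del: of_nat_Suc)
    qed
    moreover have "(m + n - k) div 2 = p + r - h" "(m - k) div 2 = p - h"
      "(n - k - 1) div 2 = r - Suc h" "(k + 1) div 2 = Suc h"
      using hp by (auto simp: m n h)
    moreover have "- ?s = (- 1) ^ Suc h" by simp
    ultimately show ?thesis by (simp only:)
  qed
  \<comment> \<open>The hypotheses determine only the products of \<open>A s\<close> and
    \<open>B s\<close> with \<open>X\<close>; the closed forms allow cancelling
    \<open>X\<close>.\<close>
  have X0: "X \<noteq> 0"
  proof (cases "even k")
    case True
    have "of_nat m - of_nat k + 1 = rat_of_nat (Suc (m - k))" using k by simp
    then have "of_nat m - of_nat k + (1 :: rat) \<noteq> 0" by (metis of_nat_neq_0)
    moreover have "of_nat m + (1 :: rat) \<noteq> 0" by (metis of_nat_Suc of_nat_neq_0 add.commute)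
    ultimately show ?thesis unfolding X_even[OF True] by simp
  next
    case False
    have "of_nat m + (1 :: rat) \<noteq> 0" "of_nat k + (1 :: rat) \<noteq> 0"
      by (metis of_nat_Suc of_nat_neq_0 add.commute)+
    then show ?thesis unfolding X_odd[OF False] by simp
  qed

  have pascal: "C (Suc M) (Suc i) = C M (Suc i) + C M i" for i
    unfolding C_def cg_sum_Suc by simp
  have A0: "of_nat (Suc M) * A 0 = of_nat (Suc M) - (- 1) ^ k * ?P"
  proof -
    have "of_nat (Suc M) * (A 0 * X) = of_nat (Suc M) * X - of_nat (Suc M) * C M p"
      using pascal[of p] A[of 0] X by (simp add: algebra_simps)
    also have "\<dots> = (of_nat (Suc M) - (- 1) ^ k * ?P) * X"
      unfolding reflect by (simp only: algebra_simps)
    finally show ?thesis using X0 by (simp only: mult.assoc[symmetric] mult_cancel_right) simp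
  qed
  have A0_even: "A 0 = (of_nat m' - of_nat m) / (of_nat m' + 1)" if "even k"
  proof -
    have "of_nat m' + (1 :: rat) = 2 * of_nat (Suc M)" "of_nat m + (1 :: rat) = 2 * ?P"
      by (simp_all add: m' m)
    then show ?thesis using A0 that by (simp add: field_simps)
  qed
  have A0_odd: "A 0 = (of_nat m' + of_nat m + 2) / (of_nat m' + 1)" if "odd k"
  proof -
    have "of_nat m' + (1 :: rat) = 2 * of_nat (Suc M)" "of_nat m + (1 :: rat) = 2 * ?P"
      by (simp_all add: m' m)
    then show ?thesis using A0 that by (simp add: field_simps)
  qed
  have B0: "B 0 = 1" using B[of 0] X X0 by simp

  have step: "A (s + 1) = ((lam m' - lam m + lam (2 * s + 1) + 1) * A s + (lam (2 * s) - lam n) * B s)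
                    / (lam m - lam (2 * s + 1)) \<and>
        B (s + 1) = ((lam m' + 1) * A s + (lam (2 * s) - lam n) * B s)
                    / (lam m - lam (2 * s + 1))" if s: "s < p" for s
  proof -
    define L where "L = lam m - lam (2 * s + 1)"
    \<comment> \<open>Since lam x + 1 = (x + 1)^2, this is the difference of squares (m + 1)^2 - (2s
      + 2)^2; it is nonzero exactly because s < p.\<close>
    have L: "L = 4 * of_nat (p - s) * of_nat (p + s + 2)"
      using s by (simp add: L_def lam_def m algebra_simps)
    have L0: "L \<noteq> 0" using s unfolding L by simp
    have BA: "B (s + 1) = A (s + 1) + A s"
    proof -
      have "B (s + 1) * X = (A (s + 1) + A s) * X"
        using B[of "s + 1"] A[of "s + 1"] A[of s] s pascal[of "Suc p + s"]
        by (simp add: distrib_right)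
      then show ?thesis using X0 by simp
    qed
    \<comment> \<open>\<open>cg_sum_raise\<close> between the two central columns, where both
      factors on its right-hand side equal M + 1, half of m' + 1.\<close>
    have raise: "of_nat (p + s + 2) * of_nat (p - s) * C (Suc M) (Suc p + (s + 1))
       + (of_nat r - of_nat s) * (of_nat r + of_nat s + 1) * C (Suc M) (Suc p + s)
      = of_nat (Suc M) * of_nat (Suc M) * C M (Suc p + s)"
    proof -
      have "of_nat (Suc (Suc p + s)) = rat_of_nat (p + s + 2)"
        "of_nat m - rat_of_nat (Suc p + s) = of_nat (p - s)"
        "of_nat (Suc M) + of_nat k - rat_of_nat (Suc p + s) = of_nat r - of_nat s"
        "of_nat n + of_nat (Suc p + s) - of_nat M - of_nat k = rat_of_nat r + of_nat s + 1"
        "of_nat m + of_nat n - 2 * of_nat k - of_nat M = rat_of_nat (Suc M)"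
        "int (Suc p + s) + 1 = int (Suc p + (s + 1))"
        using s Mrat by (simp_all add: m n algebra_simps)
      with cg_sum_raise[OF k, of "Suc p + s" M, where 'a = rat] show ?thesis
        by (simp only: C_def)
    qed
    have lams: "lam m' + 1 = 4 * (of_nat (Suc M) * of_nat (Suc M))"
      "lam (2 * s) - lam n = - 4 * ((of_nat r - of_nat s) * (of_nat r + of_nat s + 1))"
      by (simp_all add: lam_def m' n algebra_simps)
    have "L * B (s + 1) * X = ((lam m' + 1) * A s + (lam (2 * s) - lam n) * B s) * X"
    proof -
      have "L * B (s + 1) * X
          = 4 * (of_nat (p + s + 2) * of_nat (p - s) * C (Suc M) (Suc p + (s + 1)))"
      proof -
        have b: "B (s + 1) * X = C (Suc M) (Suc p + (s + 1))" using B[of "s + 1"] s by simp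
        show ?thesis unfolding b[symmetric] L by (simp only: mult_ac)
      qed
      also have "\<dots> = 4 * (of_nat (Suc M) * of_nat (Suc M) * C M (Suc p + s)
         - (of_nat r - of_nat s) * (of_nat r + of_nat s + 1) * C (Suc M) (Suc p + s))"
        using raise by (simp only: add_diff_cancel_right' flip: raise)
      also have "\<dots> = ((lam m' + 1) * A s + (lam (2 * s) - lam n) * B s) * X"
        unfolding lams B[OF less_imp_le[OF s], symmetric] A[OF less_imp_le[OF s], symmetric]
        by (simp add: algebra_simps del: of_nat_Suc)
      finally show ?thesis .
    qed
    then have LB: "L * B (s + 1) = (lam m' + 1) * A s + (lam (2 * s) - lam n) * B s"
      using X0 by simp
    \<comment> \<open>By Pascal's rule the recurrence for \<open>A\<close> is the one for
      \<open>B\<close> with \<open>L\<close> subtracted from the coefficient of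
      \<open>A s\<close>.\<close>
    have "L * A (s + 1) = L * B (s + 1) - L * A s"
      unfolding BA by (simp add: algebra_simps)
    also have "\<dots> = (lam m' - lam m + lam (2 * s + 1) + 1) * A s + (lam (2 * s) - lam n) * B s"
      unfolding LB by (simp add: L_def algebra_simps)
    finally have LA: "L * A (s + 1)
      = (lam m' - lam m + lam (2 * s + 1) + 1) * A s + (lam (2 * s) - lam n) * B s" .
    show ?thesis
      using LA LB L0 unfolding L_def[symmetric] by (simp add: nonzero_eq_divide_eq mult.commute)
  qed

  show ?thesis
    using entries[of 0] entries(1,2) X X_even X_odd A0_even A0_odd B0 step
    unfolding hm by (intro conjI allI impI) simp_all
qed

end
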